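(* Let $f:\mathbb{R}^n\to\mathbb{R}$ be continuously differentiable with locally Lipschitz continuous gradient $\nabla f$. Let $\sigma\in(0,1)$ be fixed, and let $x^0$ be feasible for the problem (MPCC). Then, for the SLPCC algorithm started at $x^0$, one of the following mutually exclusive outcomes must occur. (O1) The algorithm terminates at a B-stationary point; that is, for some $k$ and $l$, $d=0$ is a local minimizer of the subproblem $\mathrm{LPCC}(x^k,\Delta^{k,l})$, and $x^k$ is B-stationary. (O2) The algorithm generates an infinite sequence of iterates $\{x^k\}$ with decreasing objective values $f(x^k)$. If this sequence has an accumulation point, then any such accumulation point is feasible for (MPCC) and B-stationary.
   Context: Let $n_0,n_1$ be nonnegative integers, $n=n_0+2n_1$, and partition vectors of $\mathbb{R}^n$ as $x=(x_0,x_1,x_2)$ with $x_0\in\mathbb{R}^{n_0}$, $x_1,x_2\in\mathbb{R}^{n_1}$; $x_{j,i}$ is the $i$-th entry of $x_j$. Let $\ell_0,u_0\in\mathbb{R}^{n_0}$ with $\ell_{0,i}<u_{0,i}$ for all $i$. For $a,b\in\mathbb{R}^{n_1}$, $0\le a\perp b\ge 0$ means $a_i\ge0$, $b_i\ge0$, $a_ib_i=0$ for all $i$. Problem (MPCC): minimize $f(x)$ over $x\in\mathbb{R}^n$ subject to $\ell_0\le x_0\le u_0$ and $0\le x_1\perp x_2\ge0$. B-stationarity: a feasible point $x^*$ of (MPCC) is B-stationary if $d=0$ is a local minimizer of the problem: minimize $\nabla f(x^* )^Td$ over $d=(d_0,d_1,d_2)\in\mathbb{R}^n$ subject to $\ell_0\le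 x_0^*+d_0\le u_0$, $0\le x_1^*+d_1\perp x_2^*+d_2\ge0$. Subproblem: for $x\in\mathbb{R}^n$ and $\Delta>0$, $\mathrm{LPCC}(x,\Delta)$ is the problem: minimize $\nabla f(x)^Td$ over $d\in\mathbb{R}^n$ subject to $\ell_0\le x_0+d_0\le u_0$, $0\le x_1+d_1\perp x_2+d_2\ge0$, $\|d\|_\infty\le\Delta$. SLPCC algorithm. Given: $x^0$ feasible for (MPCC), $\overline\Delta^0>\underline\Delta>0$, $\sigma\in(0,1)$. For $k=0,1,2,\dots$ (outer loop): choose any $\Delta^{k,0}\in[\underline\Delta,\overline\Delta^k]$; then for $l=0,1,2,\dots$ (inner loop): (1) compute a (global) solution $d^{k,l}$ of $\mathrm{LPCC}(x^k,\Delta^{k,l})$; (2) if $d=0$ is a local minimizer of $\mathrm{LPCC}(x^k,\Delta^{k,l})$, terminate the algorithm at $x^k$; (3) compute $\rho^{k,l}=\dfrac{f(x^k)-f(x^k+d^{k,l})}{-\nabla f(x^k)^Td^{k,l}}$; (4) if $\rho^{k,l}\ge\sigma$, set $x^{k+1}=x^k+d^{k,l}$, $\overline\Delta^{k+1}=\max\{\overline\Delta^k,2\Delta^{k,l}\}$, and leave the inner loop (proceed to outer iteration $k+1$); otherwise set $\Delta^{k,l+1}=\Delta^{k,l}/2$ and continue the inner loop. *)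

theory Defs
  imports "HOL-Analysis.Analysis"
begin

text \<open>
  The space of vectors with n = n0 + 2 * n1 real entries is rendered as a real inner product space
  \<^typ>\<open>'a::real_inner\<close> with an orthonormal basis e 0, ..., e (n - 1); the entries of x are the
  numbers \<^term>\<open>inner x (e i)\<close>.  Unlike \<^typ>\<open>real^'n\<close>, whose index type is never empty, this keeps
  n0 and n1 arbitrary natural numbers, with n = 0 allowed.  The three blocks of x are
    x0 = entries 0, ..., n0 - 1,
    x1 = entries n0, ..., n0 + n1 - 1,
    x2 = entries n0 + n1, ..., n0 + 2 * n1 - 1.
\<close>

definition orthonormal_basis :: "nat \<Rightarrow> (nat \<Rightarrow> 'a::real_inner) \<Rightarrow> bool" where
  "orthonormal_basis n e \<longleftrightarrow>
     (\<forall>i<n. \<forall>j<n. e i \<bullet> e j = (if i = j then 1 else 0)) \<and> span (e ` {..<n}) = UNIV"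

text \<open>Every Euclidean space, in particular \<^typ>\<open>real^'n\<close>, has such a basis.\<close>

lemma orthonormal_basis_exists:
  "\<exists>e :: nat \<Rightarrow> 'a::euclidean_space. orthonormal_basis DIM('a) e"
proof -
  obtain e :: "nat \<Rightarrow> 'a" where e: "bij_betw e {..<DIM('a)} Basis"
    using ex_bij_betw_nat_finite[of "Basis :: 'a set"] by (auto simp: atLeast0LessThan)
  have "e i \<bullet> e j = (if i = j then 1 else 0)" if "i < DIM('a)" "j < DIM('a)" for i j
  proof -
    have "e i \<in> Basis" "e j \<in> Basis" "e i = e j \<longleftrightarrow> i = j"
      using e that by (auto simp: bij_betw_def inj_on_def)
    then show ?thesis by (simp add: inner_Basis)
  qed
  moreover have "span (e ` {..<DIM('a)}) = UNIV"
    using e by (simp add: bij_betw_def)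
  ultimately show ?thesis unfolding orthonormal_basis_def by blast
qed

text \<open>The maximum norm; inserting 0 makes it 0 when there are no entries.\<close>

definition sup_norm :: "nat \<Rightarrow> (nat \<Rightarrow> 'a::real_inner) \<Rightarrow> 'a \<Rightarrow> real" where
  "sup_norm n e d = Max (insert 0 ((\<lambda>i. \<bar>d \<bullet> e i\<bar>) ` {..<n}))"

definition gradient :: "('a::real_inner \<Rightarrow> real) \<Rightarrow> 'a \<Rightarrow> 'a" where
  "gradient f x = (THE g. GDERIV f x :> g)"

definition locally_lipschitz :: "('a::metric_space \<Rightarrow> 'b::metric_space) \<Rightarrow> bool" where
  "locally_lipschitz g \<longleftrightarrow> (\<forall>x. \<exists>r>0. \<exists>L. L-lipschitz_on (ball x r) g)"

definition local_minimizer :: "('a::metric_space \<Rightarrow> real) \<Rightarrow> 'a set \<Rightarrow> 'a \<Rightarrow> bool" where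
  "local_minimizer \<phi> S z \<longleftrightarrow>
     z \<in> S \<and> (\<exists>r>0. \<forall>y\<in>S. dist y z < r \<longrightarrow> \<phi> z \<le> \<phi> y)"

definition accumulation_point :: "(nat \<Rightarrow> 'a::topological_space) \<Rightarrow> 'a \<Rightarrow> bool" where
  "accumulation_point x z \<longleftrightarrow> (\<exists>r::nat \<Rightarrow> nat. strict_mono r \<and> (x \<circ> r) \<longlonglongrightarrow> z)"

definition mpcc_feasible ::
  "nat \<Rightarrow> nat \<Rightarrow> (nat \<Rightarrow> 'a::real_inner) \<Rightarrow> (nat \<Rightarrow> real) \<Rightarrow> (nat \<Rightarrow> real) \<Rightarrow> 'a set" where
  "mpcc_feasible n0 n1 e lo up =
     {x. (\<forall>i<n0. lo i \<le> x \<bullet> e i \<and> x \<bullet> e i \<le> up i) \<and>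
         (\<forall>i<n1. 0 \<le> x \<bullet> e (n0 + i) \<and> 0 \<le> x \<bullet> e (n0 + n1 + i) \<and>
                 (x \<bullet> e (n0 + i)) * (x \<bullet> e (n0 + n1 + i)) = 0)}"

text \<open>
  In the following, F is the feasible set of the MPCC.  The constraints that the linearized problems
  impose on d are exactly those of the MPCC imposed on x + d.
\<close>

definition b_stationary :: "'a::real_inner set \<Rightarrow> ('a \<Rightarrow> real) \<Rightarrow> 'a \<Rightarrow> bool" where
  "b_stationary F f x \<longleftrightarrow>
     x \<in> F \<and> local_minimizer (\<lambda>d. gradient f x \<bullet> d) {d. x + d \<in> F} 0"

definition lpcc_feasible ::
  "nat \<Rightarrow> (nat \<Rightarrow> 'a::real_inner) \<Rightarrow> 'a set \<Rightarrow> 'a \<Rightarrow> real \<Rightarrow> 'a set" where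
  "lpcc_feasible n e F x \<Delta> = {d. x + d \<in> F \<and> sup_norm n e d \<le> \<Delta>}"

definition lpcc_solution ::
  "nat \<Rightarrow> (nat \<Rightarrow> 'a::real_inner) \<Rightarrow> 'a set \<Rightarrow> ('a \<Rightarrow> real) \<Rightarrow> 'a \<Rightarrow> real \<Rightarrow> 'a \<Rightarrow> bool" where
  "lpcc_solution n e F f x \<Delta> d \<longleftrightarrow>
     is_arg_min (\<lambda>d. gradient f x \<bullet> d) (\<lambda>d. d \<in> lpcc_feasible n e F x \<Delta>) d"

definition lpcc_zero_local_min ::
  "nat \<Rightarrow> (nat \<Rightarrow> 'a::real_inner) \<Rightarrow> 'a set \<Rightarrow> ('a \<Rightarrow> real) \<Rightarrow> 'a \<Rightarrow> real \<Rightarrow> bool" where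
  "lpcc_zero_local_min n e F f x \<Delta> \<longleftrightarrow>
     local_minimizer (\<lambda>d. gradient f x \<bullet> d) (lpcc_feasible n e F x \<Delta>) 0"

definition reduction_ratio :: "('a::real_inner \<Rightarrow> real) \<Rightarrow> 'a \<Rightarrow> 'a \<Rightarrow> real" where
  "reduction_ratio f x d = (f x - f (x + d)) / (- (gradient f x \<bullet> d))"

text \<open>
  An execution of the SLPCC algorithm is described by the iterates x k, the upper bounds Dbar k on
  the initial radius, the radii D k l and the directions d k l.  The predicate slpcc_reached holds
  for those pairs (k, l) for which inner iteration l of outer iteration k is entered; the values of
  the sequences at all other pairs are irrelevant.  An inner iteration is left only if a solution
  of its subproblem has been computed, so an execution would get stuck at an unsolvable subproblem,
  and then it has neither of the two outcomes defined below.
\<close>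

inductive slpcc_reached ::
  "nat \<Rightarrow> (nat \<Rightarrow> 'a::real_inner) \<Rightarrow> 'a set \<Rightarrow> ('a \<Rightarrow> real) \<Rightarrow> real \<Rightarrow>
   (nat \<Rightarrow> 'a) \<Rightarrow> (nat \<Rightarrow> nat \<Rightarrow> real) \<Rightarrow> (nat \<Rightarrow> nat \<Rightarrow> 'a) \<Rightarrow> nat \<Rightarrow> nat \<Rightarrow> bool"
  for n e F f \<sigma> x D d where
  start: "slpcc_reached n e F f \<sigma> x D d 0 0"
| reject: "slpcc_reached n e F f \<sigma> x D d k (Suc l)"
  if "slpcc_reached n e F f \<sigma> x D d k l"
    and "lpcc_solution n e F f (x k) (D k l) (d k l)"
    and "\<not> lpcc_zero_local_min n e F f (x k) (D k l)"
    and "reduction_ratio f (x k) (d k l) < \<sigma>"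
| accept: "slpcc_reached n e F f \<sigma> x D d (Suc k) 0"
  if "slpcc_reached n e F f \<sigma> x D d k l"
    and "lpcc_solution n e F f (x k) (D k l) (d k l)"
    and "\<not> lpcc_zero_local_min n e F f (x k) (D k l)"
    and "reduction_ratio f (x k) (d k l) \<ge> \<sigma>"

definition slpcc_execution ::
  "nat \<Rightarrow> (nat \<Rightarrow> 'a::real_inner) \<Rightarrow> 'a set \<Rightarrow> ('a \<Rightarrow> real) \<Rightarrow> real \<Rightarrow> real \<Rightarrow> real \<Rightarrow> 'a \<Rightarrow>
   (nat \<Rightarrow> 'a) \<Rightarrow> (nat \<Rightarrow> real) \<Rightarrow> (nat \<Rightarrow> nat \<Rightarrow> real) \<Rightarrow> (nat \<Rightarrow> nat \<Rightarrow> 'a) \<Rightarrow> bool" where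
  "slpcc_execution n e F f \<sigma> Dmin Dbar0 xinit x Dbar D d \<longleftrightarrow>
     x 0 = xinit \<and> Dbar 0 = Dbar0 \<and>
     (\<forall>k. slpcc_reached n e F f \<sigma> x D d k 0 \<longrightarrow> Dmin \<le> D k 0 \<and> D k 0 \<le> Dbar k) \<and>
     (\<forall>k l. slpcc_reached n e F f \<sigma> x D d k l \<longrightarrow>
        (\<exists>s. lpcc_solution n e F f (x k) (D k l) s) \<longrightarrow>
        lpcc_solution n e F f (x k) (D k l) (d k l)) \<and>
     (\<forall>k l. slpcc_reached n e F f \<sigma> x D d k (Suc l) \<longrightarrow> D k (Suc l) = D k l / 2) \<and>
     (\<forall>k l. slpcc_reached n e F f \<sigma> x D d k l \<and>
        lpcc_solution n e F f (x k) (D k l) (d k l) \<and>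
        \<not> lpcc_zero_local_min n e F f (x k) (D k l) \<and>
        reduction_ratio f (x k) (d k l) \<ge> \<sigma> \<longrightarrow>
        x (Suc k) = x k + d k l \<and> Dbar (Suc k) = max (Dbar k) (2 * D k l))"

definition slpcc_outcome_terminates ::
  "nat \<Rightarrow> (nat \<Rightarrow> 'a::real_inner) \<Rightarrow> 'a set \<Rightarrow> ('a \<Rightarrow> real) \<Rightarrow> real \<Rightarrow>
   (nat \<Rightarrow> 'a) \<Rightarrow> (nat \<Rightarrow> nat \<Rightarrow> real) \<Rightarrow> (nat \<Rightarrow> nat \<Rightarrow> 'a) \<Rightarrow> bool" where
  "slpcc_outcome_terminates n e F f \<sigma> x D d \<longleftrightarrow>
     (\<exists>k l. slpcc_reached n e F f \<sigma> x D d k l \<and>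
        lpcc_solution n e F f (x k) (D k l) (d k l) \<and>
        lpcc_zero_local_min n e F f (x k) (D k l) \<and>
        b_stationary F f (x k))"

text \<open>That every outer iteration is entered includes that every inner loop is finite.\<close>

definition slpcc_outcome_infinite ::
  "nat \<Rightarrow> (nat \<Rightarrow> 'a::real_inner) \<Rightarrow> 'a set \<Rightarrow> ('a \<Rightarrow> real) \<Rightarrow> real \<Rightarrow>
   (nat \<Rightarrow> 'a) \<Rightarrow> (nat \<Rightarrow> nat \<Rightarrow> real) \<Rightarrow> (nat \<Rightarrow> nat \<Rightarrow> 'a) \<Rightarrow> bool" where
  "slpcc_outcome_infinite n e F f \<sigma> x D d \<longleftrightarrow>
     (\<forall>k. slpcc_reached n e F f \<sigma> x D d k 0) \<and>
     (\<forall>k. f (x (Suc k)) < f (x k)) \<and>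
     (\<forall>z. accumulation_point x z \<longrightarrow> z \<in> F \<and> b_stationary F f z)"

end

theory Submission
  imports Defs
begin

text \<open>
  Everything rests on one local fact about a feasible point z that is not B-stationary.  There are
  positive \<kappa>, c, \<Delta>0 such that for every radius \<Delta> \<le> \<Delta>0 and every x with norm (x - z) \<le> c * \<Delta>
  the solution of the linearized problem at x predicts a decrease of at least \<kappa> * \<Delta> and passes the
  acceptance test (\<open>step_accepted_near_nonstationary\<close>).

  The delicate point is that x may have other vanishing entries than z, so a feasible direction at z
  need not be feasible at x.  But the linearized problem keeps the complementarity constraint, so
  its feasible steps from x are precisely the steps to feasible points.  The feasible set contains a
  segment z + t v along a descent direction v (\<open>mpcc_feasible_locally_star_shaped\<close>), and
  one may aim at a point of this segment from x.  With a segment of length about \<Delta> the decrease is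
  of order \<Delta>, and the detour x - z costs little (\<open>linear_decrease_near_nonstationary\<close>).
  The model error is of smaller order than \<Delta>, uniformly near z (\<open>gradient_model_error\<close>),
  so the reduction ratio is at least \<sigma> < 1 once \<Delta> is small.

  This gives the two outcomes as follows.  Since B-stationarity does not depend on the radius, a run
  that does not terminate visits only points that are not B-stationary.  With z the current iterate,
  the fact shows that halving the radius ends every inner loop, so the run is infinite and f
  decreases.  With z an accumulation point, it shows that inner loops near z accept radii bounded
  away from 0, because every inner loop starts at a radius of at least Dmin.  Then f would decrease
  by a fixed amount infinitely often while its values converge to f z, which is impossible.
\<close>

section \<open>Finite orthonormal bases and the maximum norm\<close>

lemma orthonormal_basis_expansion:
  assumes "orthonormal_basis n e"
  shows "(\<Sum>i<n. (v \<bullet> e i) *\<^sub>R e i) = v"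
proof -
  let ?w = "v - (\<Sum>i<n. (v \<bullet> e i) *\<^sub>R e i)"
  have orth: "orthogonal ?w (e j)" if "j < n" for j
  proof -
    have "(\<Sum>i<n. (v \<bullet> e i) * (e i \<bullet> e j)) = (\<Sum>i<n. if i = j then v \<bullet> e i else 0)"
      using assms that by (intro sum.cong) (auto simp: orthonormal_basis_def)
    with that show ?thesis
      by (simp add: orthogonal_def inner_diff_left inner_sum_left)
  qed
  have "?w \<in> span (e ` {..<n})"
    using assms by (simp add: orthonormal_basis_def)
  moreover have "orthogonal ?w y" if "y \<in> e ` {..<n}" for y
    using orth that by auto
  ultimately have "orthogonal ?w ?w"
    by (rule orthogonal_to_span)
  then show ?thesis
    by (metis orthogonal_self eq_iff_diff_eq_0)
qed

lemma orthonormal_basis_abs_inner_le_norm: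
  assumes "orthonormal_basis n e" "i < n"
  shows "\<bar>v \<bullet> e i\<bar> \<le> norm v"
  using Cauchy_Schwarz_ineq2[of v "e i"] assms
  by (auto simp: orthonormal_basis_def norm_eq_sqrt_inner)

lemma sup_norm_le_iff:
  "0 \<le> r \<Longrightarrow> sup_norm n e v \<le> r \<longleftrightarrow> (\<forall>i<n. \<bar>v \<bullet> e i\<bar> \<le> r)"
  by (auto simp: sup_norm_def)

lemma sup_norm_le_norm:
  "orthonormal_basis n e \<Longrightarrow> sup_norm n e v \<le> norm v"
  by (simp add: sup_norm_le_iff orthonormal_basis_abs_inner_le_norm)

lemma norm_le_sup_norm:
  assumes "orthonormal_basis n e" "sup_norm n e v \<le> r" "0 \<le> r"
  shows "norm v \<le> real n * r"
proof -
  have "norm v = norm (\<Sum>i<n. (v \<bullet> e i) *\<^sub>R e i)"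
    using assms by (simp add: orthonormal_basis_expansion)
  also have "\<dots> \<le> (\<Sum>i<n. r)"
    using assms by (intro sum_norm_le)
      (auto simp: sup_norm_le_iff orthonormal_basis_def norm_eq_sqrt_inner)
  finally show ?thesis by simp
qed

lemma closed_Collect_all_less:
  fixes P :: "nat \<Rightarrow> 'a::topological_space \<Rightarrow> bool"
  assumes "\<And>i. i < n \<Longrightarrow> closed {v. P i v}"
  shows "closed {v. \<forall>i<n. P i v}"
proof -
  have "{v. \<forall>i<n. P i v} = (\<Inter>i\<in>{..<n}. {v. P i v})" by auto
  then show ?thesis using assms by auto
qed

lemma closed_sup_norm_ball:
  assumes "0 \<le> r"
  shows "closed {v. sup_norm n e v \<le> r}"
  unfolding sup_norm_le_iff[OF assms]
  by (intro closed_Collect_all_less closed_Collect_le continuous_intros)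

text \<open>The type has no Heine-Borel property by itself; it comes from the finite basis, because a box
  is a Minkowski sum of finitely many compact segments.\<close>

lemma compact_combinations:
  fixes e :: "nat \<Rightarrow> 'a::real_normed_vector"
  shows "compact {\<Sum>i<n. a i *\<^sub>R e i | a. \<forall>i<n. \<bar>a i\<bar> \<le> (r::real)}"
proof (induction n)
  case 0
  then show ?case by simp
next
  case (Suc n)
  let ?P = "{\<Sum>i<n. a i *\<^sub>R e i | a. \<forall>i<n. \<bar>a i\<bar> \<le> r}"
  let ?Q = "(\<lambda>s. s *\<^sub>R e n) ` {-r..r}"
  have "{\<Sum>i<Suc n. a i *\<^sub>R e i | a. \<forall>i<Suc n. \<bar>a i\<bar> \<le> r} = {p + q | p q. p \<in> ?P \<and> q \<in> ?Q}"
    (is "?L = ?R")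
  proof
    show "?L \<subseteq> ?R"
    proof
      fix v assume "v \<in> ?L"
      then obtain a where a: "\<forall>i<Suc n. \<bar>a i\<bar> \<le> r" "v = (\<Sum>i<n. a i *\<^sub>R e i) + a n *\<^sub>R e n"
        by auto
      then have "(\<Sum>i<n. a i *\<^sub>R e i) \<in> ?P"
        by auto
      moreover have "\<bar>a n\<bar> \<le> r"
        using a(1) by simp
      then have "a n *\<^sub>R e n \<in> ?Q"
        by (intro imageI) (auto simp: abs_le_iff)
      ultimately show "v \<in> ?R"
        using a(2) by blast
    qed
    show "?R \<subseteq> ?L"
    proof
      fix v assume "v \<in> ?R"
      then obtain a s where as: "\<forall>i<n. \<bar>a i\<bar> \<le> r" "s \<in> {-r..r}"
        "v = (\<Sum>i<n. a i *\<^sub>R e i) + s *\<^sub>R e n"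
        by blast
      have "v = (\<Sum>i<Suc n. (a(n := s)) i *\<^sub>R e i)"
        using as by simp
      moreover have "\<forall>i<Suc n. \<bar>(a(n := s)) i\<bar> \<le> r"
        using as by (auto simp: less_Suc_eq abs_le_iff)
      ultimately show "v \<in> ?L"
        by blast
    qed
  qed
  moreover have "compact ?Q"
    by (intro compact_continuous_image continuous_intros) auto
  ultimately show ?case
    using compact_sums[OF Suc] by simp
qed

lemma compact_sup_norm_ball:
  assumes "orthonormal_basis n e" "0 \<le> r"
  shows "compact {v. sup_norm n e v \<le> r}"
proof -
  have "{v. sup_norm n e v \<le> r} \<subseteq> {\<Sum>i<n. a i *\<^sub>R e i | a. \<forall>i<n. \<bar>a i\<bar> \<le> r}"
  proof safe
    fix v assume "sup_norm n e v \<le> r"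
    then show "\<exists>a. v = (\<Sum>i<n. a i *\<^sub>R e i) \<and> (\<forall>i<n. \<bar>a i\<bar> \<le> r)"
      using assms by (intro exI[of _ "\<lambda>i. v \<bullet> e i"])
        (simp add: orthonormal_basis_expansion sup_norm_le_iff)
  qed
  then show ?thesis
    using compact_Int_closed[OF compact_combinations[where n = n and e = e and r = r]
        closed_sup_norm_ball[OF assms(2), of n e]]
    by (simp only: Int_absorb1)
qed

section \<open>The feasible set\<close>

lemma closed_mpcc_feasible: "closed (mpcc_feasible n0 n1 e lo up)"
  unfolding mpcc_feasible_def
  by (intro closed_Collect_conj closed_Collect_all_less
      closed_Collect_le closed_Collect_eq continuous_intros)

lemma finite_positive_lower_bound:
  fixes h :: "nat \<Rightarrow> real"
  shows "\<exists>r>0. \<forall>i<n. 0 < h i \<longrightarrow> r \<le> h i"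
proof (induction n)
  case 0
  then show ?case by (auto intro: exI[of _ 1])
next
  case (Suc n)
  then obtain r where "0 < r" "\<forall>i<n. 0 < h i \<longrightarrow> r \<le> h i" by blast
  moreover have "0 < min r (if 0 < h n then h n else r)"
    using \<open>0 < r\<close> by simp
  ultimately show ?case
    by (intro exI[of _ "min r (if 0 < h n then h n else r)"]) (auto simp: less_Suc_eq min_le_iff_disj)
qed

lemma complementarity_segment:
  fixes p q a b t :: real
  assumes "0 \<le> p" "0 \<le> q" "p * q = 0"
    and "0 \<le> p + a" "0 \<le> q + b" "(p + a) * (q + b) = 0"
    and "0 < p \<Longrightarrow> \<bar>a\<bar> < p" "0 < q \<Longrightarrow> \<bar>b\<bar> < q"
    and "0 \<le> t" "t \<le> 1"
  shows "0 \<le> p + t * a \<and> 0 \<le> q + t * b \<and> (p + t * a) * (q + t * b) = 0"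
proof -
  have conv: "0 \<le> s + t * c" if "0 \<le> s" "0 \<le> s + c" for s c :: real
  proof -
    have "s + t * c = (1 - t) * s + t * (s + c)" by (simp add: algebra_simps)
    then show ?thesis using that \<open>0 \<le> t\<close> \<open>t \<le> 1\<close> by simp
  qed
  have "p = 0 \<or> q = 0" using assms(3) by simp
  then consider "0 < p" "q = 0" | "0 < q" "p = 0" | "p = 0" "q = 0"
    using assms(1,2) by (metis order_le_less)
  then have "(p + t * a) * (q + t * b) = 0"
  proof cases
    case 1
    then have "0 < p + a" using assms(7) by linarith
    then have "b = 0" using assms(6) 1 by simp
    with 1 show ?thesis by simp
  next
    case 2
    then have "0 < q + b" using assms(8) by linarith
    then have "a = 0" using assms(6) 2 by simp
    with 2 show ?thesis by simp
  next
    case 3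
    with assms(6) show ?thesis by auto
  qed
  then show ?thesis using conv assms(1,2,4,5) by simp
qed

text \<open>The feasible set is a finite union of convex boxes, one for each choice of the vanishing
  partner in every complementarity pair.  A feasible point close enough to z keeps the positive
  entries of z positive, so it lies in a box that also contains z.\<close>

lemma mpcc_feasible_locally_star_shaped:
  assumes basis: "orthonormal_basis n e" and n: "n = n0 + 2 * n1"
    and z: "z \<in> mpcc_feasible n0 n1 e lo up"
  shows "\<exists>r>0. \<forall>v t. norm v < r \<longrightarrow> z + v \<in> mpcc_feasible n0 n1 e lo up \<longrightarrow> 0 \<le> t \<longrightarrow> t \<le> 1 \<longrightarrow>
           z + t *\<^sub>R v \<in> mpcc_feasible n0 n1 e lo up"
proof -
  obtain r where r: "0 < r" "\<forall>i<n. 0 < z \<bullet> e i \<longrightarrow> r \<le> z \<bullet> e i"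
    using finite_positive_lower_bound[of n "\<lambda>i. z \<bullet> e i"] by blast
  have "z + t *\<^sub>R v \<in> mpcc_feasible n0 n1 e lo up"
    if v: "norm v < r" "z + v \<in> mpcc_feasible n0 n1 e lo up" and t: "0 \<le> t" "t \<le> 1" for v t
  proof -
    have small: "\<bar>v \<bullet> e i\<bar> < z \<bullet> e i" if "i < n" "0 < z \<bullet> e i" for i
      using orthonormal_basis_abs_inner_le_norm[OF basis that(1), of v] v r(2) that by force
    have "lo i \<le> z \<bullet> e i + t * (v \<bullet> e i) \<and> z \<bullet> e i + t * (v \<bullet> e i) \<le> up i" if "i < n0" for i
    proof -
      have "lo i \<le> z \<bullet> e i" "z \<bullet> e i \<le> up i" "lo i \<le> z \<bullet> e i + v \<bullet> e i" "z \<bullet> e i + v \<bullet> e i \<le> up i"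
        using z v(2) that by (auto simp: mpcc_feasible_def inner_add_left)
      then have "(1 - t) * lo i \<le> (1 - t) * (z \<bullet> e i)" "t * lo i \<le> t * (z \<bullet> e i + v \<bullet> e i)"
        "(1 - t) * (z \<bullet> e i) \<le> (1 - t) * up i" "t * (z \<bullet> e i + v \<bullet> e i) \<le> t * up i"
        using t by (auto intro!: mult_left_mono)
      then show ?thesis by (auto simp: algebra_simps)
    qed
    moreover have "0 \<le> z \<bullet> e (n0 + i) + t * (v \<bullet> e (n0 + i)) \<and>
        0 \<le> z \<bullet> e (n0 + n1 + i) + t * (v \<bullet> e (n0 + n1 + i)) \<and>
        (z \<bullet> e (n0 + i) + t * (v \<bullet> e (n0 + i))) *
          (z \<bullet> e (n0 + n1 + i) + t * (v \<bullet> e (n0 + n1 + i))) = 0"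
      if "i < n1" for i
    proof -
      have "0 \<le> z \<bullet> e (n0 + i)" "0 \<le> z \<bullet> e (n0 + n1 + i)"
        "z \<bullet> e (n0 + i) * (z \<bullet> e (n0 + n1 + i)) = 0"
        "0 \<le> z \<bullet> e (n0 + i) + v \<bullet> e (n0 + i)" "0 \<le> z \<bullet> e (n0 + n1 + i) + v \<bullet> e (n0 + n1 + i)"
        "(z \<bullet> e (n0 + i) + v \<bullet> e (n0 + i)) * (z \<bullet> e (n0 + n1 + i) + v \<bullet> e (n0 + n1 + i)) = 0"
        using z v(2) that by (simp_all add: mpcc_feasible_def inner_add_left)
      moreover have "n0 + i < n" "n0 + n1 + i < n"
        using n that by simp_all
      ultimately show ?thesis
        using small t by (intro complementarity_segment) blast+
    qed
    ultimately show ?thesis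
      by (simp add: mpcc_feasible_def inner_add_left)
  qed
  with r(1) show ?thesis by blast
qed

section \<open>Gradients\<close>

lemma GDERIV_unique:
  assumes "GDERIV f x :> g" "GDERIV f x :> h"
  shows "g = h"
proof -
  have "(\<lambda>v. v \<bullet> g) = (\<lambda>v. v \<bullet> h)"
    using assms unfolding gderiv_def by (rule has_derivative_unique)
  then have "(g - h) \<bullet> g = (g - h) \<bullet> h" by meson
  then have "(g - h) \<bullet> (g - h) = 0" by (simp add: inner_diff_right)
  then show ?thesis by simp
qed

text \<open>The finite basis replaces completeness in the Riesz representation of the derivative.\<close>

lemma has_derivative_gradient:
  fixes e :: "nat \<Rightarrow> 'a::real_inner" and f :: "'a \<Rightarrow> real"
  assumes "orthonormal_basis n e" "f differentiable (at x)"
  shows "(f has_derivative (\<lambda>v. gradient f x \<bullet> v)) (at x)"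
proof -
  obtain f' where f': "(f has_derivative f') (at x)"
    using assms by (auto simp: differentiable_def)
  then interpret f': linear f'
    by (rule has_derivative_linear)
  let ?g = "\<Sum>i<n. f' (e i) *\<^sub>R e i"
  have "f' v = v \<bullet> ?g" for v
  proof -
    have "f' v = f' (\<Sum>i<n. (v \<bullet> e i) *\<^sub>R e i)"
      by (simp only: orthonormal_basis_expansion[OF assms(1)])
    also have "\<dots> = (\<Sum>i<n. (v \<bullet> e i) * f' (e i))"
      by (simp only: f'.sum f'.scaleR real_scaleR_def)
    also have "\<dots> = v \<bullet> ?g"
      by (simp add: inner_sum_right mult.commute)
    finally show ?thesis .
  qed
  then have "f' = (\<lambda>v. v \<bullet> ?g)" by (rule ext)
  with f' have g: "GDERIV f x :> ?g"
    by (simp only: gderiv_def)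
  then have "GDERIV f x :> gradient f x"
    unfolding gradient_def by (rule theI) (rule GDERIV_unique[OF _ g])
  then show ?thesis
    by (simp add: gderiv_def inner_commute)
qed

text \<open>A continuous gradient makes the linear model accurate to first order uniformly for base
  points near z: by the mean value theorem the model error is at most the length of the step times
  the variation of the gradient along it.\<close>

lemma gradient_model_error:
  assumes der: "\<And>x. (f has_derivative (\<lambda>v. gradient f x \<bullet> v)) (at x)"
    and cont: "continuous_on UNIV (gradient f)" and "0 < \<epsilon>"
  shows "\<exists>\<eta>>0. \<forall>x v. norm (x - z) < \<eta> \<longrightarrow> norm (x + v - z) < \<eta> \<longrightarrow>
           \<bar>f (x + v) - f x - gradient f x \<bullet> v\<bar> \<le> \<epsilon> * norm v"
proof -
  obtain \<eta> where \<eta>: "0 < \<eta>" "\<And>y. norm (y - z) < \<eta> \<Longrightarrow> norm (gradient f y - gradient f z) < \<epsilon> / 2"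
    using cont \<open>0 < \<epsilon>\<close> unfolding continuous_on_iff dist_norm
    by (metis UNIV_I half_gt_zero)
  have "\<bar>f (x + v) - f x - gradient f x \<bullet> v\<bar> \<le> \<epsilon> * norm v"
    if near: "norm (x - z) < \<eta>" "norm (x + v - z) < \<eta>" for x v
  proof -
    let ?p = "\<lambda>t. x + t *\<^sub>R v"
    have "((\<lambda>t. f (?p t)) has_derivative (\<lambda>s. gradient f (?p t) \<bullet> (s *\<^sub>R v))) (at t within {0..1})" for t
      by (rule has_derivative_compose[OF _ der]) (auto intro!: derivative_eq_intros)
    then obtain t where t: "t \<in> {0<..<1}" "f (?p 1) - f (?p 0) = gradient f (?p t) \<bullet> ((1 - 0) *\<^sub>R v)"
      using mvt_simple[of 0 1 "\<lambda>t. f (?p t)" "\<lambda>t s. gradient f (?p t) \<bullet> (s *\<^sub>R v)"] by auto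
    have "?p t \<in> ball z \<eta>"
      using convexD_alt[OF convex_ball, of x z \<eta> "x + v" t] near t
      by (simp add: dist_norm norm_minus_commute algebra_simps)
    then have "norm (gradient f (?p t) - gradient f z) < \<epsilon> / 2"
      using \<eta>(2) by (metis dist_norm dist_commute mem_ball)
    moreover have "norm (gradient f x - gradient f z) < \<epsilon> / 2"
      using \<eta>(2) near by blast
    ultimately have "norm (gradient f (?p t) - gradient f x) \<le> \<epsilon>"
      using norm_triangle_ineq4[of "gradient f (?p t) - gradient f z" "gradient f x - gradient f z"]
      by simp
    then have "\<bar>(gradient f (?p t) - gradient f x) \<bullet> v\<bar> \<le> \<epsilon> * norm v"
      by (meson Cauchy_Schwarz_ineq2 mult_right_mono norm_ge_zero order_trans)
    with t show ?thesis
      by (simp add: inner_diff_left)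
  qed
  with \<eta>(1) show ?thesis by blast
qed

section \<open>One step of the linearized problem\<close>

locale smooth_mpcc =
  fixes n0 n1 n :: nat
    and e :: "nat \<Rightarrow> 'a::real_inner"
    and lo up :: "nat \<Rightarrow> real"
    and F :: "'a set"
    and f :: "'a \<Rightarrow> real"
  assumes dimension: "n = n0 + 2 * n1"
    and basis: "orthonormal_basis n e"
    and F_eq: "F = mpcc_feasible n0 n1 e lo up"
    and differentiable: "f differentiable_on UNIV"
    and gradient_continuous: "continuous_on UNIV (gradient f)"
begin

lemma f_has_derivative: "(f has_derivative (\<lambda>v. gradient f x \<bullet> v)) (at x)"
  using basis differentiable by (intro has_derivative_gradient) (auto simp: differentiable_on_def)

lemma F_closed: "closed F"
  by (simp add: F_eq closed_mpcc_feasible)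

lemma lpcc_has_solution:
  assumes "x \<in> F" "0 < \<Delta>"
  shows "\<exists>s. lpcc_solution n e F f x \<Delta> s"
proof -
  have "closed {v. x + v \<in> F}"
    using continuous_closed_vimage[OF F_closed, of "\<lambda>v. x + v"] by (simp add: vimage_def)
  moreover have "lpcc_feasible n e F x \<Delta> = {v. sup_norm n e v \<le> \<Delta>} \<inter> {v. x + v \<in> F}"
    by (auto simp: lpcc_feasible_def)
  ultimately have "compact (lpcc_feasible n e F x \<Delta>)"
    using compact_sup_norm_ball[OF basis, of \<Delta>] assms by (simp add: compact_Int_closed)
  moreover have "0 \<in> lpcc_feasible n e F x \<Delta>"
    using assms by (simp add: lpcc_feasible_def sup_norm_le_iff)
  moreover have "continuous_on (lpcc_feasible n e F x \<Delta>) (\<lambda>v. gradient f x \<bullet> v)"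
    by (intro continuous_intros)
  ultimately have "\<exists>s\<in>lpcc_feasible n e F x \<Delta>. \<forall>y\<in>lpcc_feasible n e F x \<Delta>.
      gradient f x \<bullet> s \<le> gradient f x \<bullet> y"
    by (intro continuous_attains_inf) auto
  then show ?thesis
    by (auto simp: lpcc_solution_def is_arg_min_def not_less)
qed

text \<open>Local minimality only sees short directions, on which the trust region is inactive.\<close>

lemma lpcc_zero_local_min_iff_b_stationary:
  assumes "x \<in> F" "0 < \<Delta>"
  shows "lpcc_zero_local_min n e F f x \<Delta> \<longleftrightarrow> b_stationary F f x"
proof
  assume "lpcc_zero_local_min n e F f x \<Delta>"
  then obtain r where r: "0 < r"
      "\<And>y. y \<in> lpcc_feasible n e F x \<Delta> \<Longrightarrow> norm y < r \<Longrightarrow> 0 \<le> gradient f x \<bullet> y"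
    by (auto simp: lpcc_zero_local_min_def local_minimizer_def)
  have "0 \<le> gradient f x \<bullet> y" if "x + y \<in> F" "norm y < min r \<Delta>" for y
    using that r(2)[of y] sup_norm_le_norm[OF basis, of y] by (simp add: lpcc_feasible_def)
  then show "b_stationary F f x"
    using assms r(1) by (auto simp: b_stationary_def local_minimizer_def intro!: exI[of _ "min r \<Delta>"])
next
  assume "b_stationary F f x"
  then show "lpcc_zero_local_min n e F f x \<Delta>"
    using assms by (fastforce simp: b_stationary_def lpcc_zero_local_min_def local_minimizer_def
        lpcc_feasible_def sup_norm_le_iff)
qed

lemma lpcc_solution_feasible:
  "lpcc_solution n e F f x \<Delta> s \<Longrightarrow> x + s \<in> F \<and> sup_norm n e s \<le> \<Delta>"
  by (simp add: lpcc_solution_def is_arg_min_def lpcc_feasible_def)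

lemma lpcc_solution_le:
  assumes "lpcc_solution n e F f x \<Delta> s" "x + v \<in> F" "sup_norm n e v \<le> \<Delta>"
  shows "gradient f x \<bullet> s \<le> gradient f x \<bullet> v"
  using assms by (auto simp: lpcc_solution_def is_arg_min_def lpcc_feasible_def not_less)

lemma lpcc_solution_descent:
  assumes "x \<in> F" "0 < \<Delta>" "\<not> b_stationary F f x" "lpcc_solution n e F f x \<Delta> s"
  shows "gradient f x \<bullet> s < 0"
proof -
  have "\<not> lpcc_zero_local_min n e F f x \<Delta>"
    using assms lpcc_zero_local_min_iff_b_stationary by blast
  then have "\<not> (\<forall>y\<in>lpcc_feasible n e F x \<Delta>. 0 \<le> gradient f x \<bullet> y)"
    using assms(1,2) by (auto simp: lpcc_zero_local_min_def local_minimizer_def lpcc_feasible_def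
        sup_norm_le_iff intro: exI[of _ 1])
  then obtain y where "x + y \<in> F" "sup_norm n e y \<le> \<Delta>" "gradient f x \<bullet> y < 0"
    by (auto simp: lpcc_feasible_def not_le)
  with lpcc_solution_le[OF assms(4)] show ?thesis
    by fastforce
qed

text \<open>Near a feasible point z that is not B-stationary, the linear model decreases at a rate
  proportional to the radius.  Take a feasible segment of descent directions t v at z.  Its points
  z + t v are feasible whatever the base point is, so z + t v - x is feasible at x, even when x has
  other vanishing entries than z.  The price is the offset z - x, which the condition
  norm (x - z) \<le> c \<Delta> makes small against a segment of length about \<Delta>.\<close>

lemma linear_decrease_near_nonstationary:
  assumes "z \<in> F" "\<not> b_stationary F f z"
  shows "\<exists>\<kappa>>0. \<exists>c>0. \<exists>\<Delta>0>0. \<forall>\<Delta> x. 0 < \<Delta> \<longrightarrow> \<Delta> \<le> \<Delta>0 \<longrightarrow> norm (x - z) \<le> c * \<Delta> \<longrightarrow>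
           (\<exists>v. x + v \<in> F \<and> sup_norm n e v \<le> \<Delta> \<and> gradient f x \<bullet> v \<le> - \<kappa> * \<Delta>)"
proof -
  obtain r where r: "0 < r"
    "\<And>v t. norm v < r \<Longrightarrow> z + v \<in> F \<Longrightarrow> 0 \<le> t \<Longrightarrow> t \<le> 1 \<Longrightarrow> z + t *\<^sub>R v \<in> F"
    using mpcc_feasible_locally_star_shaped[OF basis dimension] assms(1) unfolding F_eq by blast
  obtain v where v: "z + v \<in> F" "norm v < r" "gradient f z \<bullet> v < 0"
    using assms r(1) by (auto simp: b_stationary_def local_minimizer_def not_le)
  define a where "a = - (gradient f z \<bullet> v)"
  have a: "0 < a" using v by (simp add: a_def)
  have v_pos: "0 < norm v" using v(3) by auto
  define G where "G = norm (gradient f z) + 1"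
  have G: "0 < G" by (simp add: G_def add_nonneg_pos)
  obtain \<eta> where \<eta>: "0 < \<eta>"
    "\<And>x. norm (x - z) < \<eta> \<Longrightarrow> norm (gradient f x - gradient f z) < min 1 (a / (2 * norm v))"
    using gradient_continuous a v_pos unfolding continuous_on_iff dist_norm
    by (metis UNIV_I divide_pos_pos min_less_iff_conj mult_pos_pos zero_less_numeral zero_less_one)
  \<comment> \<open>The slope along v is at most - a / 2 near z, so a segment of length \<Delta> / 2 yields - 2 * \<kappa> * \<Delta>;
    c is such that the offset spends at most half of this.\<close>
  define \<kappa> where "\<kappa> = a / (8 * norm v)"
  define c where "c = min (1 / 2) (\<kappa> / G)"
  define \<Delta>0 where "\<Delta>0 = min (2 * norm v) \<eta>"
  have pos: "0 < \<kappa>" "0 < c" "0 < \<Delta>0"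
    using a v_pos G \<eta>(1) by (simp_all add: \<kappa>_def c_def \<Delta>0_def)
  have "\<exists>w. x + w \<in> F \<and> sup_norm n e w \<le> \<Delta> \<and> gradient f x \<bullet> w \<le> - \<kappa> * \<Delta>"
    if \<Delta>: "0 < \<Delta>" "\<Delta> \<le> \<Delta>0" and x: "norm (x - z) \<le> c * \<Delta>" for \<Delta> x
  proof -
    \<comment> \<open>Half of the radius pays for the segment, the other half for the offset.\<close>
    define t where "t = \<Delta> / (2 * norm v)"
    have t: "0 \<le> t" "t \<le> 1" "t * norm v = \<Delta> / 2"
      using \<Delta> v_pos by (auto simp: t_def \<Delta>0_def)
    have off: "norm (x - z) \<le> \<Delta> / 2" "G * norm (x - z) \<le> \<kappa> * \<Delta>"
    proof -
      have "c \<le> 1 / 2" "c \<le> \<kappa> / G"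
        unfolding c_def by linarith+
      then have "c * \<Delta> \<le> 1 / 2 * \<Delta>" "c * \<Delta> \<le> \<kappa> / G * \<Delta>"
        using \<Delta> by (intro mult_right_mono; simp)+
      with x have *: "norm (x - z) \<le> \<Delta> / 2" "norm (x - z) \<le> \<kappa> / G * \<Delta>" by auto
      then show "norm (x - z) \<le> \<Delta> / 2" by simp
      from *(2) G show "G * norm (x - z) \<le> \<kappa> * \<Delta>"
        by (simp add: field_simps)
    qed
    have "norm (x - z) < \<eta>"
      using off(1) \<Delta> by (auto simp: \<Delta>0_def)
    then have grad: "norm (gradient f x - gradient f z) < 1"
        "norm (gradient f x - gradient f z) * norm v < a / 2"
      using \<eta>(2) v_pos by (auto simp: field_simps)
    have "norm (gradient f x) \<le> G"
      using norm_triangle_sub[of "gradient f x" "gradient f z"] grad(1) by (simp add: G_def)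
    then have "gradient f x \<bullet> (z - x) \<le> G * norm (x - z)"
      by (metis norm_cauchy_schwarz mult_right_mono norm_ge_zero norm_minus_commute order_trans)
    moreover have "gradient f x \<bullet> v \<le> - (a / 2)"
      using norm_cauchy_schwarz[of "gradient f x - gradient f z" v] grad(2)
      by (simp add: inner_diff_left a_def)
    then have "t * (gradient f x \<bullet> v) \<le> t * - (a / 2)"
      using t(1) by (rule mult_left_mono)
    moreover have "t * - (a / 2) = - (2 * (\<kappa> * \<Delta>))"
      by (simp add: t_def \<kappa>_def)
    moreover have "gradient f x \<bullet> (z + t *\<^sub>R v - x) = gradient f x \<bullet> (z - x) + t * (gradient f x \<bullet> v)"
      by (simp add: inner_diff_right inner_add_right)
    ultimately have "gradient f x \<bullet> (z + t *\<^sub>R v - x) \<le> - \<kappa> * \<Delta>"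
      using off(2) by (simp only: minus_mult_left[symmetric])
    moreover have "norm (z + t *\<^sub>R v - x) \<le> norm (t *\<^sub>R v) + norm (z - x)"
      using norm_triangle_ineq[of "t *\<^sub>R v" "z - x"] by (simp add: algebra_simps)
    then have "norm (z + t *\<^sub>R v - x) \<le> \<Delta>"
      using t off(1) by (simp add: norm_minus_commute)
    then have "sup_norm n e (z + t *\<^sub>R v - x) \<le> \<Delta>"
      using sup_norm_le_norm[OF basis] order_trans by blast
    moreover have "x + (z + t *\<^sub>R v - x) \<in> F"
      using r(2)[OF v(2,1) t(1,2)] by simp
    ultimately show ?thesis by blast
  qed
  with pos show ?thesis by blast
qed

text \<open>The predicted decrease is of the order of the radius while the model error is of smaller
  order, so small radii near z are accepted.  The prediction for a larger radius is at least as
  good, because the feasible set of the subproblem grows with the radius.\<close>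

lemma step_accepted_near_nonstationary:
  assumes "z \<in> F" "\<not> b_stationary F f z" "\<sigma> < 1"
  shows "\<exists>\<kappa>>0. \<exists>c>0. \<exists>\<Delta>0>0. \<forall>\<Delta> x. 0 < \<Delta> \<longrightarrow> \<Delta> \<le> \<Delta>0 \<longrightarrow> norm (x - z) \<le> c * \<Delta> \<longrightarrow>
           (\<forall>\<Delta>' s. \<Delta> \<le> \<Delta>' \<longrightarrow> lpcc_solution n e F f x \<Delta>' s \<longrightarrow> gradient f x \<bullet> s \<le> - \<kappa> * \<Delta>) \<and>
           (\<forall>s. lpcc_solution n e F f x \<Delta> s \<longrightarrow> \<sigma> \<le> reduction_ratio f x s)"
proof -
  obtain \<kappa> c \<Delta>1 where pos: "0 < \<kappa>" "0 < c" "0 < \<Delta>1"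
    and dec: "\<And>\<Delta> x. 0 < \<Delta> \<Longrightarrow> \<Delta> \<le> \<Delta>1 \<Longrightarrow> norm (x - z) \<le> c * \<Delta> \<Longrightarrow>
           (\<exists>v. x + v \<in> F \<and> sup_norm n e v \<le> \<Delta> \<and> gradient f x \<bullet> v \<le> - \<kappa> * \<Delta>)"
    using linear_decrease_near_nonstationary[OF assms(1,2)] by blast
  \<comment> \<open>A step within radius \<Delta> has norm at most n * \<Delta>, so its model error is at most
    (1 - \<sigma>) * \<kappa> * \<Delta>; the summand 1 avoids division by 0 when n = 0.\<close>
  define \<epsilon> where "\<epsilon> = (1 - \<sigma>) * \<kappa> / (real n + 1)"
  have \<epsilon>: "0 < \<epsilon>" using pos assms(3) by (simp add: \<epsilon>_def)
  obtain \<eta> where \<eta>: "0 < \<eta>" "\<And>x v. norm (x - z) < \<eta> \<Longrightarrow> norm (x + v - z) < \<eta> \<Longrightarrow>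
           \<bar>f (x + v) - f x - gradient f x \<bullet> v\<bar> \<le> \<epsilon> * norm v"
    using gradient_model_error[OF f_has_derivative gradient_continuous \<epsilon>, of z] by blast
  define \<Delta>0 where "\<Delta>0 = min \<Delta>1 (\<eta> / (c + real n + 1))"
  have pred: "gradient f x \<bullet> s \<le> - \<kappa> * \<Delta>"
    if \<Delta>: "0 < \<Delta>" "\<Delta> \<le> \<Delta>0" and x: "norm (x - z) \<le> c * \<Delta>"
      and "\<Delta> \<le> \<Delta>'" and s: "lpcc_solution n e F f x \<Delta>' s"
    for \<Delta> \<Delta>' x s
  proof -
    obtain v where "x + v \<in> F" "sup_norm n e v \<le> \<Delta>" "gradient f x \<bullet> v \<le> - \<kappa> * \<Delta>"
      using dec[of \<Delta> x] \<Delta> x unfolding \<Delta>0_def min.bounded_iff by blast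
    with lpcc_solution_le[OF s, of v] \<open>\<Delta> \<le> \<Delta>'\<close> show ?thesis by linarith
  qed
  have acc: "\<sigma> \<le> reduction_ratio f x s"
    if \<Delta>: "0 < \<Delta>" "\<Delta> \<le> \<Delta>0" and x: "norm (x - z) \<le> c * \<Delta>"
      and s: "lpcc_solution n e F f x \<Delta> s" for \<Delta> x s
  proof -
    let ?p = "- (gradient f x \<bullet> s)"
    have p: "\<kappa> * \<Delta> \<le> ?p" using pred[OF \<Delta> x order_refl s] by simp
    have norm_s: "norm s \<le> real n * \<Delta>"
      using lpcc_solution_feasible[OF s] norm_le_sup_norm[OF basis] \<Delta> by simp
    have "\<Delta> \<le> \<eta> / (c + real n + 1)"
      using \<Delta> by (simp add: \<Delta>0_def)
    moreover have "0 < c + real n + 1" using pos(2) by simp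
    ultimately have "\<Delta> * (c + real n + 1) \<le> \<eta>"
      by (metis pos_le_divide_eq)
    then have "c * \<Delta> + real n * \<Delta> < \<eta>"
      using \<Delta> by (simp add: algebra_simps)
    moreover have "norm (x + s - z) \<le> norm (x - z) + norm s"
      using norm_triangle_ineq[of "x - z" s] by (simp add: algebra_simps)
    moreover have "0 \<le> real n * \<Delta>" using \<Delta> by simp
    ultimately have "\<bar>f (x + s) - f x - gradient f x \<bullet> s\<bar> \<le> \<epsilon> * norm s"
      using x norm_s by (intro \<eta>(2)) linarith+
    also have "\<dots> \<le> \<epsilon> * ((real n + 1) * \<Delta>)"
      using norm_s \<epsilon> \<Delta> by (intro mult_left_mono) (auto simp: algebra_simps)
    also have "\<dots> = (1 - \<sigma>) * (\<kappa> * \<Delta>)"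
    proof -
      have "\<epsilon> * (real n + 1) = (1 - \<sigma>) * \<kappa>"
        using of_nat_0_le_iff[of n, where 'a = real] by (simp add: \<epsilon>_def)
      then show ?thesis by (metis mult.assoc)
    qed
    also have "\<dots> \<le> (1 - \<sigma>) * ?p"
      using p assms(3) by (intro mult_left_mono) auto
    finally have "\<sigma> * ?p \<le> f x - f (x + s)"
      by (simp add: algebra_simps abs_le_iff)
    moreover have "0 < \<kappa> * \<Delta>" using pos \<Delta> by simp
    then have "0 < ?p" using p by linarith
    ultimately show ?thesis
      unfolding reduction_ratio_def by (simp only: pos_le_divide_eq)
  qed
  have "0 < \<Delta>0" using pos \<eta>(1) by (simp add: \<Delta>0_def)
  moreover have "(\<forall>\<Delta>' s. \<Delta> \<le> \<Delta>' \<longrightarrow> lpcc_solution n e F f x \<Delta>' s \<longrightarrow> gradient f x \<bullet> s \<le> - \<kappa> * \<Delta>) \<and>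
      (\<forall>s. lpcc_solution n e F f x \<Delta> s \<longrightarrow> \<sigma> \<le> reduction_ratio f x s)"
    if "0 < \<Delta>" "\<Delta> \<le> \<Delta>0" "norm (x - z) \<le> c * \<Delta>" for \<Delta> x
    using pred[OF that] acc[OF that] by blast
  ultimately show ?thesis
    using pos(1,2) by blast
qed

end

section \<open>Runs of the algorithm\<close>

locale slpcc_run = smooth_mpcc n0 n1 n e lo up F f
  for n0 n1 n :: nat
    and e :: "nat \<Rightarrow> 'a::real_inner"
    and lo up :: "nat \<Rightarrow> real"
    and F :: "'a set"
    and f :: "'a \<Rightarrow> real" +
  fixes \<sigma> Dmin Dbar0 :: real
    and xinit :: 'a
    and x :: "nat \<Rightarrow> 'a"
    and Dbar :: "nat \<Rightarrow> real"
    and D :: "nat \<Rightarrow> nat \<Rightarrow> real"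
    and d :: "nat \<Rightarrow> nat \<Rightarrow> 'a"
  assumes \<sigma>_pos: "0 < \<sigma>" and \<sigma>_less_1: "\<sigma> < 1"
    and Dmin_pos: "0 < Dmin"
    and xinit_feasible: "xinit \<in> F"
    and execution: "slpcc_execution n e F f \<sigma> Dmin Dbar0 xinit x Dbar D d"
begin

abbreviation reached :: "nat \<Rightarrow> nat \<Rightarrow> bool" where
  "reached \<equiv> slpcc_reached n e F f \<sigma> x D d"

lemma initial_radius_ge: "reached k 0 \<Longrightarrow> Dmin \<le> D k 0"
  using execution by (simp add: slpcc_execution_def)

lemma radius_halved: "reached k (Suc l) \<Longrightarrow> D k (Suc l) = D k l / 2"
  using execution by (simp add: slpcc_execution_def)

lemma accepted_iterate:
  assumes "reached k l" "lpcc_solution n e F f (x k) (D k l) (d k l)"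
    "\<not> lpcc_zero_local_min n e F f (x k) (D k l)" "\<sigma> \<le> reduction_ratio f (x k) (d k l)"
  shows "x (Suc k) = x k + d k l"
  using execution assms by (simp add: slpcc_execution_def)

lemma reached_feasible: "reached k l \<Longrightarrow> x k \<in> F \<and> 0 < D k l"
proof (induction rule: slpcc_reached.induct)
  case start
  then show ?case
    using initial_radius_ge[OF slpcc_reached.start] Dmin_pos xinit_feasible execution
    by (simp add: slpcc_execution_def)
next
  case (reject k l)
  then show ?case
    using radius_halved[OF slpcc_reached.reject[OF reject.hyps]] by simp
next
  case (accept k l)
  then have "x (Suc k) = x k + d k l"
    by (intro accepted_iterate) auto
  then show ?case
    using lpcc_solution_feasible[OF accept.hyps(2)] Dmin_pos
      initial_radius_ge[OF slpcc_reached.accept[OF accept.hyps]] by simp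
qed

lemma direction_solution:
  assumes "reached k l"
  shows "lpcc_solution n e F f (x k) (D k l) (d k l)"
  using execution assms reached_feasible[OF assms] lpcc_has_solution
  unfolding slpcc_execution_def by blast

lemma zero_local_min_iff:
  "reached k l \<Longrightarrow> lpcc_zero_local_min n e F f (x k) (D k l) \<longleftrightarrow> b_stationary F f (x k)"
  using lpcc_zero_local_min_iff_b_stationary reached_feasible by blast

lemma accepted_decrease:
  assumes "reached k l" "\<not> b_stationary F f (x k)" "\<sigma> \<le> reduction_ratio f (x k) (d k l)"
  shows "f (x (Suc k)) \<le> f (x k) + \<sigma> * (gradient f (x k) \<bullet> d k l)"
    and "gradient f (x k) \<bullet> d k l < 0"
proof -
  have sol: "lpcc_solution n e F f (x k) (D k l) (d k l)"
    using assms(1) by (rule direction_solution)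
  then show neg: "gradient f (x k) \<bullet> d k l < 0"
    using assms reached_feasible lpcc_solution_descent by blast
  have "x (Suc k) = x k + d k l"
    using assms sol zero_local_min_iff by (intro accepted_iterate) auto
  moreover have "\<sigma> * - (gradient f (x k) \<bullet> d k l) \<le> f (x k) - f (x k + d k l)"
    using assms(3) neg unfolding reduction_ratio_def by (subst (asm) pos_le_divide_eq) auto
  ultimately show "f (x (Suc k)) \<le> f (x k) + \<sigma> * (gradient f (x k) \<bullet> d k l)"
    by simp
qed

text \<open>The base point stays fixed in an inner loop, so it may itself serve as the nonstationary
  point in the acceptance lemma; halving drives the radius below the threshold found there.\<close>

lemma inner_loop_accepts:
  assumes "reached k 0" "\<not> b_stationary F f (x k)"
  shows "\<exists>l. reached k l \<and> \<sigma> \<le> reduction_ratio f (x k) (d k l)"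
proof (rule ccontr)
  assume "\<not> ?thesis"
  then have rej: "reached k l \<Longrightarrow> reduction_ratio f (x k) (d k l) < \<sigma>" for l
    by (auto simp: not_le)
  have all: "reached k l" for l
  proof (induction l)
    case (Suc l)
    have "\<not> lpcc_zero_local_min n e F f (x k) (D k l)"
      using zero_local_min_iff[OF Suc] assms(2) by simp
    then show ?case
      by (rule slpcc_reached.reject[OF Suc direction_solution[OF Suc] _ rej[OF Suc]])
  qed (rule assms(1))
  have D: "D k l = D k 0 * (1 / 2) ^ l" for l
    by (induction l) (simp_all add: radius_halved all)
  obtain \<kappa> c \<Delta>0 where c: "0 < c" "0 < \<Delta>0"
    and near: "\<forall>\<Delta> y. 0 < \<Delta> \<longrightarrow> \<Delta> \<le> \<Delta>0 \<longrightarrow> norm (y - x k) \<le> c * \<Delta> \<longrightarrow>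
           (\<forall>\<Delta>' s. \<Delta> \<le> \<Delta>' \<longrightarrow> lpcc_solution n e F f y \<Delta>' s \<longrightarrow> gradient f y \<bullet> s \<le> - \<kappa> * \<Delta>) \<and>
           (\<forall>s. lpcc_solution n e F f y \<Delta> s \<longrightarrow> \<sigma> \<le> reduction_ratio f y s)"
    using step_accepted_near_nonstationary[OF conjunct1[OF reached_feasible[OF assms(1)]] assms(2) \<sigma>_less_1]
    by (elim exE conjE) (rule that)
  have D0: "0 < D k 0" using reached_feasible[OF assms(1)] by blast
  then obtain l where "(1 / 2) ^ l < \<Delta>0 / D k 0"
    using real_arch_pow_inv[of "\<Delta>0 / D k 0" "1 / 2"] c by auto
  then have "D k l \<le> \<Delta>0"
    using D0 by (simp add: D[of l] pos_less_divide_eq mult.commute)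
  moreover have "0 < D k l"
    using reached_feasible[OF all] by blast
  moreover from this have "norm (x k - x k) \<le> c * D k l"
    using c by simp
  ultimately have "\<sigma> \<le> reduction_ratio f (x k) (d k l)"
    using near direction_solution[OF all] by blast
  with rej[OF all] show False by (meson not_le)
qed

lemma next_iteration_reached:
  assumes "reached k 0" "\<not> b_stationary F f (x k)"
  shows "reached (Suc k) 0"
proof -
  obtain l where l: "reached k l" "\<sigma> \<le> reduction_ratio f (x k) (d k l)"
    using inner_loop_accepts[OF assms] by blast
  have "\<not> lpcc_zero_local_min n e F f (x k) (D k l)"
    using zero_local_min_iff[OF l(1)] assms(2) by simp
  then show ?thesis
    by (rule slpcc_reached.accept[OF l(1) direction_solution[OF l(1)] _ l(2)])
qed

text \<open>Suppose that an accumulation point z were not B-stationary, and let R be a radius that is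
  accepted near z and at most Dmin.  An inner loop at an iterate near z starts with a radius at
  least R and stops no later than at its first radius in [R / 2, R], so accepted radii are at least
  R / 2.  Each visit to the neighbourhood of z therefore lowers f by a fixed amount, although the
  values of f decrease to f z.\<close>

lemma accumulation_point_b_stationary:
  assumes reached: "\<And>k. reached k 0" and nonstat: "\<And>k. \<not> b_stationary F f (x k)"
    and "accumulation_point x z"
  shows "b_stationary F f z"
proof (rule ccontr)
  assume z_nonstat: "\<not> b_stationary F f z"
  obtain r where r: "strict_mono r" "(x \<circ> r) \<longlonglongrightarrow> z"
    using assms(3) by (auto simp: accumulation_point_def)
  have z: "z \<in> F"
    using closed_sequentially[OF F_closed _ r(2)] reached reached_feasible by auto
  have dec: "f (x (Suc k)) \<le> f (x k)" for k
  proof -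
    obtain l where l: "reached k l" "\<sigma> \<le> reduction_ratio f (x k) (d k l)"
      using inner_loop_accepts[OF reached nonstat] by blast
    have "\<sigma> * (gradient f (x k) \<bullet> d k l) \<le> 0"
      using accepted_decrease(2)[OF l(1) nonstat l(2)] \<sigma>_pos by (simp add: mult_le_0_iff)
    then show ?thesis
      using accepted_decrease(1)[OF l(1) nonstat l(2)] by simp
  qed
  have "isCont f z"
    using f_has_derivative has_derivative_continuous by blast
  then have f_lim: "(\<lambda>j. f (x (r j))) \<longlonglongrightarrow> f z"
    using isCont_tendsto_compose[OF _ r(2)] by (simp add: o_def)
  have f_ge: "f z \<le> f (x k)" for k
  proof -
    have "f (x (r j)) \<le> f (x k)" if "k \<le> j" for j
      using lift_Suc_antimono_le[of "\<lambda>k. f (x k)", OF dec] that strict_mono_imp_increasing[OF r(1), of j]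
      by (meson order_trans)
    then show ?thesis
      using f_lim by (intro LIMSEQ_le_const2) auto
  qed
  obtain \<kappa> c \<Delta>0 where pos: "0 < \<kappa>" "0 < c" "0 < \<Delta>0"
    and near: "\<forall>\<Delta> y. 0 < \<Delta> \<longrightarrow> \<Delta> \<le> \<Delta>0 \<longrightarrow> norm (y - z) \<le> c * \<Delta> \<longrightarrow>
           (\<forall>\<Delta>' s. \<Delta> \<le> \<Delta>' \<longrightarrow> lpcc_solution n e F f y \<Delta>' s \<longrightarrow> gradient f y \<bullet> s \<le> - \<kappa> * \<Delta>) \<and>
           (\<forall>s. lpcc_solution n e F f y \<Delta> s \<longrightarrow> \<sigma> \<le> reduction_ratio f y s)"
    using step_accepted_near_nonstationary[OF z z_nonstat \<sigma>_less_1]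
    by (elim exE conjE) (rule that)
  define R where "R = min \<Delta>0 Dmin"
  have R: "0 < R" "R \<le> \<Delta>0" "R \<le> Dmin"
    using pos Dmin_pos by (auto simp: R_def)
  have near_drop: "f (x (Suc k)) \<le> f (x k) - \<sigma> * (\<kappa> * (R / 2))"
    if close: "norm (x k - z) \<le> c * (R / 2)" for k
  proof -
    have radius: "reached k l \<Longrightarrow> R / 2 \<le> D k l" for l
    proof (induction l)
      case 0
      then show ?case using initial_radius_ge R by fastforce
    next
      case (Suc l)
      then have l: "reached k l" "reduction_ratio f (x k) (d k l) < \<sigma>"
        by (auto elim: slpcc_reached.cases)
      have "R < D k l"
      proof (rule ccontr)
        assume "\<not> R < D k l"
        then have "D k l \<le> \<Delta>0" using R by simp
        moreover have "c * (R / 2) \<le> c * D k l"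
          using Suc.IH[OF l(1)] pos by (intro mult_left_mono) auto
        then have "norm (x k - z) \<le> c * D k l"
          using close by simp
        ultimately have "\<sigma> \<le> reduction_ratio f (x k) (d k l)"
          using near reached_feasible[OF l(1)] direction_solution[OF l(1)] by blast
        with l(2) show False by simp
      qed
      then show ?case
        using radius_halved[OF Suc.prems] by simp
    qed
    obtain l where l: "reached k l" "\<sigma> \<le> reduction_ratio f (x k) (d k l)"
      using inner_loop_accepts[OF reached nonstat] by blast
    have "0 < R / 2" "R / 2 \<le> \<Delta>0" using R by simp_all
    then have "gradient f (x k) \<bullet> d k l \<le> - \<kappa> * (R / 2)"
      using near close radius[OF l(1)] direction_solution[OF l(1)] by blast
    then have "\<sigma> * (gradient f (x k) \<bullet> d k l) \<le> \<sigma> * (- \<kappa> * (R / 2))"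
      using \<sigma>_pos by (intro mult_left_mono) auto
    then show ?thesis
      using accepted_decrease(1)[OF l(1) nonstat l(2)] by simp
  qed
  have "\<forall>\<^sub>F j in sequentially. norm (x (r j) - z) < c * (R / 2)"
    using tendstoD[OF r(2), of "c * (R / 2)"] pos R by (simp add: dist_norm)
  moreover have "\<forall>\<^sub>F j in sequentially. f (x (r j)) < f z + \<sigma> * (\<kappa> * (R / 2))"
    using order_tendstoD(2)[OF f_lim] pos R \<sigma>_pos by simp
  ultimately have "\<forall>\<^sub>F j in sequentially. f (x (Suc (r j))) < f z"
  proof eventually_elim
    case (elim j)
    then show ?case using near_drop[of "r j"] by linarith
  qed
  then show False
    using f_ge by (auto simp: eventually_sequentially not_less[symmetric])
qed

lemma infinite_outcome:
  assumes "\<not> slpcc_outcome_terminates n e F f \<sigma> x D d"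
  shows "slpcc_outcome_infinite n e F f \<sigma> x D d"
proof -
  have nonstat_reached: "\<not> b_stationary F f (x k)" if "reached k 0" for k
    using assms that direction_solution zero_local_min_iff
    unfolding slpcc_outcome_terminates_def by blast
  have reached: "reached k 0" for k
    by (induction k) (simp_all add: slpcc_reached.start next_iteration_reached nonstat_reached)
  have nonstat: "\<not> b_stationary F f (x k)" for k
    using nonstat_reached reached by blast
  have "f (x (Suc k)) < f (x k)" for k
  proof -
    obtain l where l: "reached k l" "\<sigma> \<le> reduction_ratio f (x k) (d k l)"
      using inner_loop_accepts[OF reached nonstat] by blast
    have "\<sigma> * (gradient f (x k) \<bullet> d k l) < 0"
      using accepted_decrease(2)[OF l(1) nonstat l(2)] \<sigma>_pos by (simp add: mult_less_0_iff)
    then show ?thesis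
      using accepted_decrease(1)[OF l(1) nonstat l(2)] by simp
  qed
  moreover have "b_stationary F f z" if "accumulation_point x z" for z
    using accumulation_point_b_stationary[OF reached nonstat that] .
  ultimately show ?thesis
    using reached by (auto simp: slpcc_outcome_infinite_def b_stationary_def)
qed

lemma outcomes_exclusive:
  assumes "slpcc_outcome_terminates n e F f \<sigma> x D d"
  shows "\<not> slpcc_outcome_infinite n e F f \<sigma> x D d"
proof
  assume "slpcc_outcome_infinite n e F f \<sigma> x D d"
  then have all: "reached k 0" for k
    by (simp add: slpcc_outcome_infinite_def)
  obtain k where k: "b_stationary F f (x k)"
    using assms by (auto simp: slpcc_outcome_terminates_def)
  \<comment> \<open>The step that led to iteration k + 1 was taken at a point x k that is not B-stationary.\<close>
  from all[of "Suc k"] obtain l where "reached k l" "\<not> lpcc_zero_local_min n e F f (x k) (D k l)"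
    by (auto elim: slpcc_reached.cases)
  with k show False
    using zero_local_min_iff by blast
qed

end

theorem theorem4p2:
  fixes n0 n1 n :: nat
    and e :: "nat \<Rightarrow> 'a::real_inner"
    and lo up :: "nat \<Rightarrow> real"
    and F :: "'a set"
    and f :: "'a \<Rightarrow> real"
    and \<sigma> Dmin Dbar0 :: real
    and xinit :: 'a
    and x :: "nat \<Rightarrow> 'a"
    and Dbar :: "nat \<Rightarrow> real"
    and D :: "nat \<Rightarrow> nat \<Rightarrow> real"
    and d :: "nat \<Rightarrow> nat \<Rightarrow> 'a"
  assumes "n = n0 + 2 * n1"
    and "orthonormal_basis n e"
    and "\<forall>i<n0. lo i < up i"
    and "F = mpcc_feasible n0 n1 e lo up"
    and "f differentiable_on UNIV"
    and "continuous_on UNIV (gradient f)"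
    and "locally_lipschitz (gradient f)"
    and "0 < \<sigma>" and "\<sigma> < 1"
    and "0 < Dmin" and "Dmin < Dbar0"
    and "xinit \<in> F"
    and "slpcc_execution n e F f \<sigma> Dmin Dbar0 xinit x Dbar D d"
  shows "(slpcc_outcome_terminates n e F f \<sigma> x D d \<or> slpcc_outcome_infinite n e F f \<sigma> x D d) \<and>
         \<not> (slpcc_outcome_terminates n e F f \<sigma> x D d \<and> slpcc_outcome_infinite n e F f \<sigma> x D d)"
proof -
  interpret slpcc_run n0 n1 n e lo up F f \<sigma> Dmin Dbar0 xinit x Dbar D d
    using assms by unfold_locales auto
  show ?thesis
    using infinite_outcome outcomes_exclusive by blast
qed

end
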